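(* Let $V$ be a vertex operator algebra and $g$ an automorphism of $V$ of finite order $p$, with $\zeta$ a primitive $p$-th root of unity and $V=\bigoplus_{i=0}^{p-1}V^i$, $V^i=\{v\in V: gv=\zeta^iv\}$. Let $W$ be an irreducible weak $V$-module such that $W\circ g\cong W$. Then $W$ is a completely reducible weak $V^0$-module such that: (1) $W=\bigoplus_{i=0}^{p-1}W^i$ with $V^i.W^j\subset W^{(i+j)\bmod p}$, where $W^0,\dots,W^{p-1}$ are eigenspaces of a certain linear isomorphism $\Phi(g):W\to W$; (2) each $W^i$ is an irreducible weak $V^0$-module; (3) the modules $W^i$, $i=0,\dots,p-1$, are pairwise non-isomorphic as weak $V^0$-modules.
   Context: All vector spaces are over $\mathbb{C}$. A vertex operator algebra $V$ is $\mathbb{Z}$-graded with finite-dimensional graded pieces that vanish in sufficiently small degree, satisfying the usual axioms; $Y(v,z)=\sum_n v_nz^{-n-1}$. An automorphism of $V$ is a linear automorphism $g$ with $g(a_nb)=g(a)_ng(b)$ and $g(\omega)=\omega$. $V^0=V^{\langle g\rangle}$ is the vertex subalgebra of fixed points. A weak $V$-module is a vector space $W$ with $Y_W:V\to\mathrm{End}(W)[[z,z^{-1}]]$ satisfying lower truncation ($a_nw=0$ for $n$ large), $Y_W(\mathbf 1,z)=\mathrm{Id}$ and the Jacobi identity (no grading required). $W\circ g$ is the space $W$ with $Y_{W\circ g}(v,z)=Y_W(gv,z)$. For subspaces $A\subset V$, $B\subset W$, $A.B=\mathrm{Span}_{\mathbb{C}}\{v_nw: v\in A,w\in B,n\in\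mathbb{Z}\}$.
   Formalization: Adds that for 0<k<p, Y_W(g^k v,z) is not identically Y_W(v,z) (automatic for simple V, implied by the conclusion); without it the claim fails, e.g. V=C[x]/(x^2), gx=-x, p=2, W=V/(x). *)

theory Defs
  imports Complex_Main "HOL-Library.Groups_Big_Fun"
begin

text \<open>
  A complex vector space is a type with a scalar multiplication satisfying
  \<^locale>\<open>vector_space\<close>; subspaces are sets. A vertex operator \<open>Y(a,z) = \<Sum> a\<^sub>n z\<^sup>-\<^sup>n\<^sup>-\<^sup>1\<close> is given
  by its modes: \<open>Y a n b\<close> stands for \<open>a\<^sub>n b\<close>.
\<close>

definition direct_sum_of ::
  "(complex \<Rightarrow> 'a::ab_group_add \<Rightarrow> 'a) \<Rightarrow> 'i set \<Rightarrow> ('i \<Rightarrow> 'a set) \<Rightarrow> 'a set \<Rightarrow> bool" where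
  "direct_sum_of scale I U M \<longleftrightarrow>
     (\<forall>i\<in>I. module.subspace scale (U i)) \<and>
     M = module.span scale (\<Union>i\<in>I. U i) \<and>
     (\<forall>J x. finite J \<and> J \<subseteq> I \<and> (\<forall>i\<in>J. x i \<in> U i) \<and> (\<Sum>i\<in>J. x i) = 0 \<longrightarrow> (\<forall>i\<in>J. x i = 0))"

definition eigenspace :: "(complex \<Rightarrow> 'a \<Rightarrow> 'a) \<Rightarrow> ('a \<Rightarrow> 'a) \<Rightarrow> complex \<Rightarrow> 'a set" where
  "eigenspace scale f c = {x. f x = scale c x}"

text \<open>
  The Jacobi identity
  \<open>z\<^sub>0\<^sup>-\<^sup>1 \<delta>((z\<^sub>1-z\<^sub>2)/z\<^sub>0) Y(a,z\<^sub>1)Y(b,z\<^sub>2)w - z\<^sub>0\<^sup>-\<^sup>1 \<delta>((z\<^sub>2-z\<^sub>1)/(-z\<^sub>0)) Y(b,z\<^sub>2)Y(a,z\<^sub>1)w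
     = z\<^sub>2\<^sup>-\<^sup>1 \<delta>((z\<^sub>1-z\<^sub>0)/z\<^sub>2) Y(Y(a,z\<^sub>0)b,z\<^sub>2)w\<close>,
  read off at the coefficient of \<open>z\<^sub>0\<^sup>-\<^sup>l\<^sup>-\<^sup>1 z\<^sub>1\<^sup>-\<^sup>m\<^sup>-\<^sup>1 z\<^sub>2\<^sup>-\<^sup>n\<^sup>-\<^sup>1\<close>. Powers of a binomial are expanded in
  nonnegative powers of its second variable; on the right-hand side
  \<open>(-1)\<^sup>i binom(i-m-1,i) = binom(m,i)\<close> has been used. Under lower truncation all three sums
  have finite support, so that \<^const>\<open>Sum_any\<close> is their actual value.
\<close>

definition jacobi_identity ::
  "('v \<Rightarrow> int \<Rightarrow> 'v \<Rightarrow> 'v) \<Rightarrow> 'v set \<Rightarrow>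
   (complex \<Rightarrow> 'w::ab_group_add \<Rightarrow> 'w) \<Rightarrow> ('v \<Rightarrow> int \<Rightarrow> 'w \<Rightarrow> 'w) \<Rightarrow> 'w set \<Rightarrow> bool" where
  "jacobi_identity Y A sW YW M \<longleftrightarrow>
     (\<forall>a\<in>A. \<forall>b\<in>A. \<forall>w\<in>M. \<forall>l m n :: int.
        Sum_any (\<lambda>i::nat. sW ((-1) ^ i * (of_int l gchoose i))
                             (YW a (m + l - int i) (YW b (n + int i) w)))
      - Sum_any (\<lambda>i::nat. sW ((-1) powi l * (-1) ^ i * (of_int l gchoose i))
                             (YW b (n + l - int i) (YW a (m + int i) w)))
      = Sum_any (\<lambda>i::nat. sW (of_int m gchoose i)
                             (YW (Y a (l + int i) b) (m + n - int i) w)))"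

locale vertex_algebra = vector_space scale
  for scale :: "complex \<Rightarrow> 'v::ab_group_add \<Rightarrow> 'v" +
  fixes Y :: "'v \<Rightarrow> int \<Rightarrow> 'v \<Rightarrow> 'v" and vac :: 'v
  assumes linear_left: "Vector_Spaces.linear scale scale (\<lambda>a. Y a n b)"
    and linear_right: "Vector_Spaces.linear scale scale (\<lambda>b. Y a n b)"
    and truncation: "\<exists>N. \<forall>n\<ge>N. Y a n b = 0"
    and vacuum: "Y vac n b = (if n = -1 then b else 0)"
    and creation: "Y a (-1) vac = a" "n \<ge> 0 \<Longrightarrow> Y a n vac = 0"
    and jacobi: "jacobi_identity Y UNIV scale Y UNIV"
begin

definition vertex_subalgebra :: "'v set \<Rightarrow> bool" where
  "vertex_subalgebra A \<longleftrightarrow> subspace A \<and> vac \<in> A \<and> (\<forall>a\<in>A. \<forall>b\<in>A. \<forall>n. Y a n b \<in> A)"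

end

text \<open>Here \<open>L(n) = \<omega>\<^sub>n\<^sub>+\<^sub>1\<close>, and \<open>gr n\<close> is the homogeneous subspace of weight \<open>n\<close>.\<close>

locale vertex_operator_algebra = vertex_algebra scale Y vac
  for scale :: "complex \<Rightarrow> 'v::ab_group_add \<Rightarrow> 'v"
    and Y :: "'v \<Rightarrow> int \<Rightarrow> 'v \<Rightarrow> 'v" and vac :: 'v +
  fixes omega :: 'v and gr :: "int \<Rightarrow> 'v set"
  assumes grading: "direct_sum_of scale UNIV gr UNIV"
    and grading_finite_dim: "\<exists>B. finite B \<and> gr n = span B"
    and grading_bounded_below: "\<exists>N. \<forall>n<N. gr n = {0}"
    and vac_weight: "vac \<in> gr 0"
    and omega_weight: "omega \<in> gr 2"
    and virasoro: "\<exists>c. \<forall>m n a.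
        Y omega (m + 1) (Y omega (n + 1) a) - Y omega (n + 1) (Y omega (m + 1) a) =
        scale (of_int (m - n)) (Y omega (m + n + 1) a) +
        (if m + n = 0 then scale (of_int (m ^ 3 - m) / 12 * c) a else 0)"
    and L0_weight: "a \<in> gr n \<Longrightarrow> Y omega 1 a = scale (of_int n) a"
    and L_minus_1_derivative: "Y (Y omega 0 a) n b = scale (- of_int n) (Y a (n - 1) b)"

definition voa_automorphism ::
  "(complex \<Rightarrow> 'v::ab_group_add \<Rightarrow> 'v) \<Rightarrow> ('v \<Rightarrow> int \<Rightarrow> 'v \<Rightarrow> 'v) \<Rightarrow> 'v \<Rightarrow> ('v \<Rightarrow> 'v) \<Rightarrow> bool" where
  "voa_automorphism scale Y omega g \<longleftrightarrow>
     Vector_Spaces.linear scale scale g \<and> bij g \<and>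
     (\<forall>a n b. g (Y a n b) = Y (g a) n (g b)) \<and> g omega = omega"

definition has_order :: "('a \<Rightarrow> 'a) \<Rightarrow> nat \<Rightarrow> bool" where
  "has_order g p \<longleftrightarrow> p > 0 \<and> g ^^ p = id \<and> (\<forall>k. 0 < k \<and> k < p \<longrightarrow> g ^^ k \<noteq> id)"

definition primitive_root_of_unity :: "nat \<Rightarrow> complex \<Rightarrow> bool" where
  "primitive_root_of_unity p z \<longleftrightarrow> p > 0 \<and> z ^ p = 1 \<and> (\<forall>k. 0 < k \<and> k < p \<longrightarrow> z ^ k \<noteq> 1)"

definition fixed_subalgebra :: "('v \<Rightarrow> 'v) \<Rightarrow> 'v set" where
  "fixed_subalgebra g = {v. g v = v}"

text \<open>
  Weak modules over a vertex subalgebra \<open>A\<close> (possibly the whole algebra) of a vertex algebra, on a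
  subspace \<open>M\<close> (possibly the whole space) of the type \<open>'w\<close>. Only the values of \<open>YW\<close> at arguments
  in \<open>A\<close> and \<open>M\<close> matter.
\<close>

locale weak_module =
  V: vertex_algebra sV Y vac + W: vector_space sW
  for sV :: "complex \<Rightarrow> 'v::ab_group_add \<Rightarrow> 'v" and Y :: "'v \<Rightarrow> int \<Rightarrow> 'v \<Rightarrow> 'v" and vac :: 'v
    and A :: "'v set"
    and sW :: "complex \<Rightarrow> 'w::ab_group_add \<Rightarrow> 'w" and YW :: "'v \<Rightarrow> int \<Rightarrow> 'w \<Rightarrow> 'w"
    and M :: "'w set" +
  assumes subalgebra: "V.vertex_subalgebra A"
    and subspace: "W.subspace M"
    and closed: "a \<in> A \<Longrightarrow> w \<in> M \<Longrightarrow> YW a n w \<in> M"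
    and add_left: "a \<in> A \<Longrightarrow> b \<in> A \<Longrightarrow> w \<in> M \<Longrightarrow> YW (a + b) n w = YW a n w + YW b n w"
    and scale_left: "a \<in> A \<Longrightarrow> w \<in> M \<Longrightarrow> YW (sV c a) n w = sW c (YW a n w)"
    and add_right: "a \<in> A \<Longrightarrow> w \<in> M \<Longrightarrow> x \<in> M \<Longrightarrow> YW a n (w + x) = YW a n w + YW a n x"
    and scale_right: "a \<in> A \<Longrightarrow> w \<in> M \<Longrightarrow> YW a n (sW c w) = sW c (YW a n w)"
    and truncation: "a \<in> A \<Longrightarrow> w \<in> M \<Longrightarrow> \<exists>N. \<forall>n\<ge>N. YW a n w = 0"
    and vacuum: "w \<in> M \<Longrightarrow> YW vac n w = (if n = -1 then w else 0)"
    and jacobi: "jacobi_identity Y A sW YW M"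

definition irreducible_weak_module ::
  "(complex \<Rightarrow> 'v::ab_group_add \<Rightarrow> 'v) \<Rightarrow> ('v \<Rightarrow> int \<Rightarrow> 'v \<Rightarrow> 'v) \<Rightarrow> 'v \<Rightarrow> 'v set \<Rightarrow>
   (complex \<Rightarrow> 'w::ab_group_add \<Rightarrow> 'w) \<Rightarrow> ('v \<Rightarrow> int \<Rightarrow> 'w \<Rightarrow> 'w) \<Rightarrow> 'w set \<Rightarrow> bool" where
  "irreducible_weak_module sV Y vac A sW YW M \<longleftrightarrow>
     weak_module sV Y vac A sW YW M \<and> M \<noteq> {0} \<and>
     (\<forall>U. module.subspace sW U \<and> U \<subseteq> M \<and> (\<forall>a\<in>A. \<forall>n. \<forall>u\<in>U. YW a n u \<in> U)
          \<longrightarrow> U = {0} \<or> U = M)"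

definition completely_reducible_weak_module ::
  "(complex \<Rightarrow> 'v::ab_group_add \<Rightarrow> 'v) \<Rightarrow> ('v \<Rightarrow> int \<Rightarrow> 'v \<Rightarrow> 'v) \<Rightarrow> 'v \<Rightarrow> 'v set \<Rightarrow>
   (complex \<Rightarrow> 'w::ab_group_add \<Rightarrow> 'w) \<Rightarrow> ('v \<Rightarrow> int \<Rightarrow> 'w \<Rightarrow> 'w) \<Rightarrow> 'w set \<Rightarrow> bool" where
  "completely_reducible_weak_module sV Y vac A sW YW M \<longleftrightarrow>
     weak_module sV Y vac A sW YW M \<and>
     (\<exists>S :: 'w set set. (\<forall>U\<in>S. irreducible_weak_module sV Y vac A sW YW U) \<and>
        direct_sum_of sW S (\<lambda>U. U) M)"

definition isomorphic_weak_modules ::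
  "'v set \<Rightarrow> (complex \<Rightarrow> 'w::ab_group_add \<Rightarrow> 'w) \<Rightarrow> ('v \<Rightarrow> int \<Rightarrow> 'w \<Rightarrow> 'w) \<Rightarrow> 'w set \<Rightarrow>
   (complex \<Rightarrow> 'x::ab_group_add \<Rightarrow> 'x) \<Rightarrow> ('v \<Rightarrow> int \<Rightarrow> 'x \<Rightarrow> 'x) \<Rightarrow> 'x set \<Rightarrow> bool" where
  "isomorphic_weak_modules A sM YM M sN YN N \<longleftrightarrow>
     (\<exists>f. bij_betw f M N \<and>
        (\<forall>x\<in>M. \<forall>y\<in>M. f (x + y) = f x + f y) \<and>
        (\<forall>c. \<forall>x\<in>M. f (sM c x) = sN c (f x)) \<and>
        (\<forall>a\<in>A. \<forall>n. \<forall>x\<in>M. f (YM a n x) = YN a n (f x)))"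

text \<open>The vertex operator map of \<open>W \<circ> g\<close>.\<close>

definition twist :: "('v \<Rightarrow> 'v) \<Rightarrow> ('v \<Rightarrow> int \<Rightarrow> 'w \<Rightarrow> 'w) \<Rightarrow> 'v \<Rightarrow> int \<Rightarrow> 'w \<Rightarrow> 'w" where
  "twist g YW = (\<lambda>v. YW (g v))"

text \<open>\<open>A.B\<close>, the span of all \<open>v\<^sub>n w\<close>.\<close>

definition mode_span ::
  "(complex \<Rightarrow> 'w::ab_group_add \<Rightarrow> 'w) \<Rightarrow> ('v \<Rightarrow> int \<Rightarrow> 'w \<Rightarrow> 'w) \<Rightarrow> 'v set \<Rightarrow> 'w set \<Rightarrow> 'w set" where
  "mode_span sW YW A B = module.span sW {YW v n w | v n w. v \<in> A \<and> w \<in> B}"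

end

theory Submission
  imports Defs "HOL-Library.Product_Plus" "HOL-Computational_Algebra.Fundamental_Theorem_Algebra"
    "HOL-Analysis.Continuum_Not_Denumerable"
begin

text \<open>
  \<open>V\<close> has countable dimension, hence so has \<open>W\<close>, and Schur's lemma holds by Dixmier's argument.
  The inverse \<open>h\<close> of an isomorphism \<open>W \<circ> g \<rightarrow> W\<close> satisfies \<open>h a\<^sub>n = (g a)\<^sub>n h\<close>; since
  \<open>h\<^sup>p\<close> is a scalar, \<open>h\<close> can be rescaled to \<open>\<Phi>\<close> with \<open>\<Phi>\<^sup>p = 1\<close>, and \<open>W\<close> splits into the eigenspaces
  \<open>W\<^sup>i\<close>. By the Jacobi identity the \<open>v\<^sub>n w\<close> with \<open>v \<in> V\<close> span a submodule, so \<open>V.w = W\<close> for \<open>w \<noteq> 0\<close>;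
  taking degrees, \<open>V\<^sup>0.w = W\<^sup>i\<close> for \<open>w \<in> W\<^sup>i\<close>, which gives irreducibility.
\<close>

section \<open>Polynomials in a linear operator, and Dixmier's argument\<close>

locale complex_operator = vector_space scale
  for scale :: "complex \<Rightarrow> 'a::ab_group_add \<Rightarrow> 'a" +
  fixes T :: "'a \<Rightarrow> 'a"
  assumes linear_T: "Vector_Spaces.linear scale scale T"
begin

sublocale T: Vector_Spaces.linear scale scale T
  by (rule linear_T)

lemma linear_funpow: "Vector_Spaces.linear scale scale (T ^^ k)"
proof -
  have "(T ^^ k) (x + y) = (T ^^ k) x + (T ^^ k) y" "(T ^^ k) (scale c x) = scale c ((T ^^ k) x)"
    for x y c
    by (induction k) (auto simp: T.add T.scale)
  then show ?thesis
    by unfold_locales auto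
qed

sublocale funpow: Vector_Spaces.linear scale scale "T ^^ k" for k
  by (rule linear_funpow)

text \<open>This is \<open>q(T) x\<close>, computed by Horner's scheme.\<close>

definition poly_act :: "complex poly \<Rightarrow> 'a \<Rightarrow> 'a" where
  "poly_act q = fold_coeffs (\<lambda>c h x. scale c x + T (h x)) q (\<lambda>x. 0)"

lemma poly_act_0 [simp]: "poly_act 0 x = 0"
  by (simp add: poly_act_def)

lemma poly_act_pCons [simp]: "poly_act (pCons c q) x = scale c x + T (poly_act q x)"
  by (cases "c = 0 \<and> q = 0") (auto simp: poly_act_def T.zero)

lemma poly_act_add: "poly_act (q + r) x = poly_act q x + poly_act r x"
  by (induction q r rule: poly_induct2) (auto simp: scale_left_distrib T.add)

lemma poly_act_smult: "poly_act (smult c q) x = scale c (poly_act q x)"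
  by (induction q) (auto simp: scale_right_distrib T.scale)

lemma poly_act_mult: "poly_act (q * r) x = poly_act q (poly_act r x)"
  by (induction q) (auto simp: poly_act_add poly_act_smult)

lemma poly_act_zero_right [simp]: "poly_act q 0 = 0"
  by (induction q) (auto simp: T.zero)

lemma poly_act_add_right: "poly_act q (x + y) = poly_act q x + poly_act q y"
  by (induction q) (auto simp: scale_right_distrib T.add algebra_simps)

lemma poly_act_scale_right: "poly_act q (scale c x) = scale c (poly_act q x)"
  by (induction q) (auto simp: scale_right_distrib T.scale mult.commute)

lemma poly_act_sum: "poly_act (\<Sum>i\<in>I. q i) x = (\<Sum>i\<in>I. poly_act (q i) x)"
  by (induction I rule: infinite_finite_induct) (auto simp: poly_act_add)

lemma poly_act_sum_right: "poly_act q (\<Sum>i\<in>I. x i) = (\<Sum>i\<in>I. poly_act q (x i))"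
  by (induction I rule: infinite_finite_induct) (auto simp: poly_act_add_right)

text \<open>Up to a nonzero constant, \<open>q\<close> is a product of factors \<open>X - z\<close>,
  and the absence of eigenvalues makes every \<open>T - z\<close> injective. The induction splits
  off one root at a time.\<close>

lemma poly_act_inj:
  assumes no_eigenvalue: "\<And>c x. T x = scale c x \<Longrightarrow> x = 0"
    and "q \<noteq> 0" "poly_act q x = 0"
  shows "x = 0"
  using assms(2,3)
proof (induction "degree q" arbitrary: q)
  case 0
  then obtain c where "q = [:c:]" "c \<noteq> 0"
    by (metis degree_eq_zeroE pCons_0_0)
  with 0 show ?case
    by (simp add: T.zero)
next
  case (Suc n)
  then have "\<not> constant (poly q)"
    by (simp add: constant_degree)
  then obtain z where "poly q z = 0"
    using fundamental_theorem_of_algebra by blast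
  then obtain r where r: "q = [:- z, 1:] * r"
    by (auto simp: poly_eq_0_iff_dvd)
  with Suc have "r \<noteq> 0" by auto
  then have "degree q = Suc (degree r)"
    unfolding r by (subst degree_mult_eq) auto
  moreover have "poly_act r x = 0"
  proof (rule no_eigenvalue)
    have "poly_act [:- z, 1:] (poly_act r x) = 0"
      using Suc(4) unfolding r poly_act_mult .
    then show "T (poly_act r x) = scale z (poly_act r x)"
      by (simp add: T.zero)
  qed
  ultimately show ?case
    using Suc \<open>r \<noteq> 0\<close> by simp
qed

text \<open>Think of \<open>r c\<close> as \<open>(T - c)^-1 w\<close>. Applying the product of all
  \<open>T - e\<close> with \<open>e \<in> F\<close> clears denominators and turns the relation into
  \<open>q(T) w = 0\<close>, which \<open>poly_act_inj\<close> excludes for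
  \<open>q \<noteq> 0\<close> and \<open>w \<noteq> 0\<close>.\<close>

lemma resolvent_independent:
  assumes no_eigenvalue: "\<And>c x. T x = scale c x \<Longrightarrow> x = 0"
    and res: "\<And>c. T (r c) = scale c (r c) + w"
    and "w \<noteq> 0" "finite F" "(\<Sum>c\<in>F. scale (u c) (r c)) = 0" "d \<in> F"
  shows "u d = 0"
proof (rule ccontr)
  assume "u d \<noteq> 0"
  define Q where "Q c = (\<Prod>e\<in>F - {c}. [:- e, 1:])" for c :: complex
  define q where "q = (\<Sum>c\<in>F. smult (u c) (Q c))"
  \<comment> \<open>Evaluation at \<open>d\<close> isolates \<open>u d\<close>, since every other
    \<open>Q c\<close> contains the factor \<open>X - d\<close>.\<close>
  have "poly (Q c) d = 0" if "c \<in> F" "c \<noteq> d" for c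
    using that assms unfolding Q_def by (auto simp: poly_prod intro!: prod_zero)
  then have "poly q d = u d * poly (Q d) d"
    unfolding q_def using assms
    by (simp add: poly_sum sum.remove[of _ d])
  moreover have "poly (Q d) d \<noteq> 0"
    unfolding Q_def using assms by (auto simp: poly_prod)
  ultimately have "q \<noteq> 0"
    using \<open>u d \<noteq> 0\<close> by auto
  have "poly_act (Q c) w = poly_act (\<Prod>e\<in>F. [:- e, 1:]) (r c)" if "c \<in> F" for c
  proof -
    have "(\<Prod>e\<in>F. [:- e, 1:]) = Q c * [:- c, 1:]"
      unfolding Q_def using prod.remove[of F c "\<lambda>e. [:- e, 1:]"] assms that
      by (simp only: mult.commute)
    then show ?thesis
      by (simp add: poly_act_mult res T.zero del: mult_pCons_right)
  qed
  then have "poly_act q w = poly_act (\<Prod>e\<in>F. [:- e, 1:]) (\<Sum>c\<in>F. scale (u c) (r c))"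
    unfolding q_def poly_act_sum poly_act_sum_right
    by (intro sum.cong) (auto simp: poly_act_smult poly_act_scale_right)
  also have "\<dots> = 0"
    using assms by simp
  finally have "w = 0"
    using no_eigenvalue \<open>q \<noteq> 0\<close> by (blast intro: poly_act_inj)
  with assms show False by simp
qed

text \<open>Dixmier's trick: if \<open>T - c\<close> were invertible for all \<open>c\<close>, the vectors \<open>(T - c)\<^sup>-\<^sup>1 w\<close> would
  form an uncountable independent set.\<close>

lemma exists_singular_value:
  assumes "countable B" "span B = UNIV" "w \<noteq> 0"
  shows "\<exists>c. (\<exists>x. x \<noteq> 0 \<and> T x = scale c x) \<or> (\<forall>x. T x \<noteq> scale c x + w)"
proof (rule ccontr)
  assume "\<not> ?thesis"
  then have no_eigenvalue: "\<And>c x. T x = scale c x \<Longrightarrow> x = 0"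
    and "\<And>c. \<exists>x. T x = scale c x + w"
    by auto
  then obtain r where res: "\<And>c. T (r c) = scale c (r c) + w"
    by metis
  have indep: "u d = 0" if "finite F" "(\<Sum>c\<in>F. scale (u c) (r c)) = 0" "d \<in> F" for F u d
    by (rule resolvent_independent[of r w F u]) (use no_eigenvalue res \<open>w \<noteq> 0\<close> that in auto)
  have "inj r"
  proof (rule injI)
    fix c d assume "r c = r d"
    show "c = d"
    proof (rule ccontr)
      assume "c \<noteq> d"
      then show False
        using indep[where F = "{c, d}" and u = "\<lambda>e. if e = c then 1 else - 1" and d = c] \<open>r c = r d\<close> by auto
    qed
  qed
  have independent: "independent (range r)"
    unfolding independent_explicit_module
  proof (intro allI impI)
    fix t u v
    assume t: "finite t" "t \<subseteq> range r" "(\<Sum>v\<in>t. scale (u v) v) = 0" "v \<in> t"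
    then obtain F where F: "finite F" "t = r ` F"
      by (meson finite_subset_image)
    then obtain d where "v = r d" "d \<in> F"
      using t by auto
    moreover have "(\<Sum>c\<in>F. scale (u (r c)) (r c)) = 0"
      using t(3) \<open>inj r\<close> unfolding F(2) by (subst (asm) sum.reindex) (auto intro: inj_on_subset)
    ultimately show "u v = 0"
      using indep[where F = F and u = "\<lambda>c. u (r c)"] F by auto
  qed
  define e where "e = from_nat_into (insert 0 B)"
  have e: "range e = insert 0 B"
    unfolding e_def using assms by (intro range_from_nat_into) auto
  \<comment> \<open>A finite-dimensional subspace contains only finitely many of the independent
    vectors \<open>r c\<close>. Since the initial segments of \<open>e\<close> exhaust the space,
    the complex numbers would be a countable union of finite sets.\<close>
  have finite: "finite {c. r c \<in> span (e ` {..n})}" for n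
  proof -
    have "finite (range r \<inter> span (e ` {..n}))"
      using independent_span_bound[of "e ` {..n}" "range r \<inter> span (e ` {..n})"]
        independent_mono[OF independent] by auto
    then have "finite (r -` (range r \<inter> span (e ` {..n})))"
      using \<open>inj r\<close> by (intro finite_vimageI)
    then show ?thesis
      by (simp add: vimage_def)
  qed
  have "\<exists>n. x \<in> span (e ` {..n})" for x
  proof -
    have "x \<in> span (range e)"
      using assms e by (simp add: span_insert_0)
    then show ?thesis
    proof (induction rule: span_induct_alt)
      case base
      then show ?case by (auto intro: span_zero)
    next
      case (step c b y)
      then obtain m n where "b = e m" "y \<in> span (e ` {..n})" by auto
      then have "b \<in> span (e ` {..max m n})" "y \<in> span (e ` {..max m n})"
        by (auto intro: span_base span_mono[THEN subsetD, of "e ` {..n}"])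
      then show ?case
        by (blast intro: span_add span_scale)
    qed
  qed
  then have "\<exists>n. r c \<in> span (e ` {..n})" for c .
  then have "UNIV = (\<Union>n. {c. r c \<in> span (e ` {..n})})"
    by blast
  moreover have "countable (\<Union>n. {c. r c \<in> span (e ` {..n})})"
    by (intro countable_UN countable_finite[OF finite]) simp
  ultimately have "countable (range complex_of_real)"
    by (metis countable_subset subset_UNIV)
  then have "countable (UNIV :: real set)"
    by (rule countable_image_inj_on) (rule inj_of_real)
  then show False
    using uncountable_UNIV_real by blast
qed

end

section \<open>Roots of unity and the eigenspace decomposition of an operator of finite
  order\<close>

lemma sum_powers_root_of_unity:
  fixes z :: complex
  assumes "z ^ p = 1" "z \<noteq> 1"
  shows "(\<Sum>k<p. z ^ k) = 0"
  using geometric_sum[of z p] assms by simp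

lemma primitive_root_inj:
  assumes "primitive_root_of_unity p z"
  shows "inj_on ((^) z) {..<p}"
proof -
  have nz: "z \<noteq> 0"
    using assms unfolding primitive_root_of_unity_def by (auto simp: zero_power)
  have "i = j" if "i < p" "j < p" "z ^ i = z ^ j" "i \<le> j" for i j
  proof (rule ccontr)
    assume "i \<noteq> j"
    have "z ^ i * z ^ (j - i) = z ^ j"
      using that by (metis le_add_diff_inverse power_add)
    then have "z ^ i * z ^ (j - i) = z ^ i * 1"
      using that by simp
    then have "z ^ (j - i) = 1" using nz by simp
    with that \<open>i \<noteq> j\<close> assms show False
      unfolding primitive_root_of_unity_def by auto
  qed
  then show ?thesis
    by (intro inj_onI) (metis lessThan_iff nat_le_linear)
qed

lemma primitive_root_power_eq_1:
  assumes "primitive_root_of_unity p z"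
  shows "(z ^ i) ^ p = 1"
  using assms unfolding primitive_root_of_unity_def
  by (metis mult.commute power_mult power_one)

locale finite_order_operator = complex_operator +
  fixes p :: nat
  assumes order_pos: "p > 0" and funpow_order: "T ^^ p = id"
begin

text \<open>For \<open>c ^ p = 1\<close> this is the projection onto the eigenspace of
  \<open>c\<close>: a Fourier coefficient for the cyclic group generated by
  \<open>T\<close>.\<close>

definition proj :: "complex \<Rightarrow> 'a \<Rightarrow> 'a" where
  "proj c x = scale (1 / of_nat p) (\<Sum>k<p. scale (inverse c ^ k) ((T ^^ k) x))"

lemma funpow_eigenvector: "T x = scale d x \<Longrightarrow> (T ^^ k) x = scale (d ^ k) x"
  by (induction k) (auto simp: T.scale mult.commute)

lemma root_nonzero: "(c::complex) ^ p = 1 \<Longrightarrow> c \<noteq> 0"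
  using zero_power[OF order_pos, where ?'a = complex] by (cases "c = 0") simp_all

lemma proj_in_eigenspace:
  assumes "c ^ p = 1"
  shows "proj c x \<in> eigenspace scale T c"
proof -
  define f where "f k = scale (inverse c ^ k) ((T ^^ k) x)" for k
  have nz: "c \<noteq> 0" using assms by (rule root_nonzero)
  \<comment> \<open>The terms have period \<open>p\<close>, so the index shift caused by
    \<open>T\<close> does not change their sum.\<close>
  have "f p = f 0"
    using assms by (simp add: f_def funpow_order power_inverse)
  have "T (proj c x) = scale (1 / of_nat p) (\<Sum>k<p. scale c (f (Suc k)))"
    using nz by (simp add: proj_def f_def T.scale T.sum flip: mult.assoc)
  also have "\<dots> = scale c (scale (1 / of_nat p) (\<Sum>k<p. f (Suc k)))"
    by (simp add: mult.commute flip: scale_sum_right)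
  also have "(\<Sum>k<p. f (Suc k)) = (\<Sum>k<p. f k)"
    using sum.lessThan_Suc_shift[of f p] \<open>f p = f 0\<close> by simp
  finally show ?thesis
    by (simp add: eigenspace_def proj_def f_def)
qed

lemma proj_eigenvector:
  assumes "T x = scale d x" "c ^ p = 1" "d ^ p = 1"
  shows "proj c x = (if c = d then x else 0)"
proof -
  have nz: "c \<noteq> 0" using assms by (intro root_nonzero)
  have "proj c x = scale (1 / of_nat p * (\<Sum>k<p. (d / c) ^ k)) x"
    by (simp add: proj_def funpow_eigenvector[OF assms(1)] divide_inverse power_mult_distrib mult.commute
        flip: scale_sum_left)
  moreover have "(\<Sum>k<p. (d / c) ^ k) = 0" if "c \<noteq> d"
    using assms that nz by (intro sum_powers_root_of_unity) (auto simp: power_divide)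
  ultimately show ?thesis
    using nz order_pos by auto
qed

lemma linear_proj: "Vector_Spaces.linear scale scale (proj c)"
  by unfold_locales
    (auto simp: proj_def funpow.add funpow.scale scale_right_distrib sum.distrib scale_sum_right mult_ac)

sublocale proj: Vector_Spaces.linear scale scale "proj c" for c
  by (rule linear_proj)

lemma subspace_eigenspace: "subspace (eigenspace scale T c)"
  by (auto simp: subspace_def eigenspace_def T.zero T.add T.scale algebra_simps)

text \<open>Orthogonality of characters: once the two sums are swapped, the coefficient of
  \<open>(T ^^ k) x\<close> is a sum of powers of a root of unity, which vanishes unless
  \<open>k = 0\<close>.\<close>

lemma sum_proj:
  assumes "primitive_root_of_unity p \<zeta>"
  shows "(\<Sum>i<p. proj (\<zeta> ^ i) x) = x"
proof -
  have "(\<Sum>i<p. (inverse (\<zeta> ^ k)) ^ i) = (if k = 0 then of_nat p else 0)" if "k < p" for k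
  proof (cases "k = 0")
    case False
    then have "inverse (\<zeta> ^ k) \<noteq> 1" "inverse (\<zeta> ^ k) ^ p = 1"
      using assms that primitive_root_power_eq_1[OF assms]
      unfolding primitive_root_of_unity_def by (auto simp: power_inverse)
    with False show ?thesis by (simp add: sum_powers_root_of_unity)
  qed simp
  then have eq: "(\<Sum>i<p. (inverse (\<zeta> ^ i)) ^ k) = (if k = 0 then of_nat p else 0)" if "k < p" for k
    using that by (simp only: power_inverse mult.commute[of _ k] flip: power_mult)
  have "(\<Sum>i<p. proj (\<zeta> ^ i) x) =
      scale (1 / of_nat p) (\<Sum>i<p. \<Sum>k<p. scale (inverse (\<zeta> ^ i) ^ k) ((T ^^ k) x))"
    by (simp add: proj_def scale_sum_right)
  also have "\<dots> = scale (1 / of_nat p) (\<Sum>k<p. scale (\<Sum>i<p. inverse (\<zeta> ^ i) ^ k) ((T ^^ k) x))"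
    by (subst sum.swap) (simp add: scale_sum_left)
  also have "\<dots> = scale (1 / of_nat p) (\<Sum>k<p. if k = 0 then scale (of_nat p) x else 0)"
    by (intro arg_cong[of _ _ "scale _"] sum.cong) (auto simp: eq)
  also have "\<dots> = x"
    using order_pos by simp
  finally show ?thesis .
qed

lemma direct_sum_eigenspaces:
  assumes "primitive_root_of_unity p \<zeta>"
  shows "direct_sum_of scale {..<p} (\<lambda>i. eigenspace scale T (\<zeta> ^ i)) UNIV"
  unfolding direct_sum_of_def
proof (intro conjI allI impI ballI)
  show "subspace (eigenspace scale T (\<zeta> ^ i))" for i
    by (rule subspace_eigenspace)
  have "(\<Sum>i<p. proj (\<zeta> ^ i) x) \<in> span (\<Union>i<p. eigenspace scale T (\<zeta> ^ i))" for x
    using proj_in_eigenspace primitive_root_power_eq_1[OF assms]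
    by (intro span_sum span_base) blast
  then have "x \<in> span (\<Union>i<p. eigenspace scale T (\<zeta> ^ i))" for x
    by (simp only: sum_proj[OF assms])
  then show "UNIV = span (\<Union>i<p. eigenspace scale T (\<zeta> ^ i))"
    by blast
next
  fix J x j
  assume *: "finite J \<and> J \<subseteq> {..<p} \<and> (\<forall>i\<in>J. x i \<in> eigenspace scale T (\<zeta> ^ i)) \<and> sum x J = 0"
    and "j \<in> J"
  have "proj (\<zeta> ^ j) (x i) = (if i = j then x i else 0)" if "i \<in> J" for i
    using * that \<open>j \<in> J\<close> primitive_root_inj[OF assms] primitive_root_power_eq_1[OF assms]
    by (subst proj_eigenvector[of _ "\<zeta> ^ i"]) (auto simp: eigenspace_def dest: inj_onD)
  then have "(\<Sum>i\<in>J. proj (\<zeta> ^ j) (x i)) = (\<Sum>i\<in>J. if i = j then x i else 0)"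
    by (intro sum.cong) auto
  then have "proj (\<zeta> ^ j) (sum x J) = x j"
    using conjunct1[OF *] \<open>j \<in> J\<close> by (simp add: proj.sum)
  then show "x j = 0"
    using * by (simp add: proj.zero)
qed

end

section \<open>Consequences of the Jacobi identity: generated submodules and annihilators\<close>

lemma Sum_any_eq_sum_lessThan:
  assumes "\<And>i. i \<ge> K \<Longrightarrow> f i = 0"
  shows "Sum_any f = sum f {..<K::nat}"
  using assms by (intro Sum_any.expand_superset) (auto simp: not_le[symmetric])

locale full_weak_module = weak_module sV Y vac UNIV sW YW UNIV
  for sV :: "complex \<Rightarrow> 'v::ab_group_add \<Rightarrow> 'v" and Y vac
    and sW :: "complex \<Rightarrow> 'w::ab_group_add \<Rightarrow> 'w" and YW
begin

lemma linear_mode: "Vector_Spaces.linear sW sW (YW a n)"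
  by unfold_locales (auto simp: add_right scale_right)

lemma linear_state: "Vector_Spaces.linear sV sW (\<lambda>a. YW a n w)"
  by unfold_locales (auto simp: add_left scale_left)

sublocale mode: Vector_Spaces.linear sW sW "YW a n" for a n
  by (rule linear_mode)

sublocale state: Vector_Spaces.linear sV sW "\<lambda>a. YW a n w" for n w
  by (rule linear_state)

lemma jacobi_eq:
  "Sum_any (\<lambda>i::nat. sW ((-1) ^ i * (of_int l gchoose i)) (YW a (m + l - int i) (YW b (n + int i) w)))
   - Sum_any (\<lambda>i::nat. sW ((-1) powi l * (-1) ^ i * (of_int l gchoose i))
                             (YW b (n + l - int i) (YW a (m + int i) w)))
   = Sum_any (\<lambda>i::nat. sW (of_int m gchoose i) (YW (Y a (l + int i) b) (m + n - int i) w))"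
  using jacobi unfolding jacobi_identity_def by blast

text \<open>The \<open>i = 0\<close> term of the sum is \<open>a\<^sub>k b\<^sub>n w\<close>; all others involve \<open>b\<^sub>j w\<close> with \<open>j > n\<close>, so that
  lower truncation permits a downward induction on \<open>n\<close>.\<close>

lemma mode_product_memI:
  assumes "W.subspace P"
    and rel: "\<And>k n. \<exists>l. Sum_any (\<lambda>i::nat. sW ((-1) ^ i * (of_int l gchoose i))
                (YW a (k - int i) (YW b (n + int i) w))) \<in> P"
  shows "YW a k (YW b n w) \<in> P"
proof -
  obtain N where N: "\<And>n. n \<ge> N \<Longrightarrow> YW b n w = 0"
    using truncation by blast
  show ?thesis
  proof (induction "nat (N - n)" arbitrary: k n rule: less_induct)
    case less
    show ?case
    proof (cases "n \<ge> N")
      case True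
      then show ?thesis
        using N W.subspace_0[OF assms(1)] by (simp add: mode.zero)
    next
      case False
      define K where "K = nat (N - n)"
      have "K > 0"
        using False by (simp add: K_def)
      then obtain K' where K': "K = Suc K'"
        using gr0_implies_Suc by blast
      obtain l where l: "Sum_any (\<lambda>i::nat. sW ((-1) ^ i * (of_int l gchoose i))
                (YW a (k - int i) (YW b (n + int i) w))) \<in> P"
        using rel by blast
      define f where "f i = sW ((-1) ^ i * (of_int l gchoose i))
                (YW a (k - int i) (YW b (n + int i) w))" for i
      have "Sum_any f = sum f {..<K}"
        using N by (intro Sum_any_eq_sum_lessThan) (auto simp: f_def K_def mode.zero)
      also have "\<dots> = f 0 + (\<Sum>i<K'. f (Suc i))"
        unfolding K' by (rule sum.lessThan_Suc_shift)
      also have "f 0 = YW a k (YW b n w)"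
        by (simp add: f_def)
      finally have "YW a k (YW b n w) = Sum_any f - (\<Sum>i<K'. f (Suc i))"
        by simp
      moreover have "YW a k' (YW b (n + int (Suc i)) w) \<in> P" for k' i
        using False by (intro less) auto
      then have "(\<Sum>i<K'. f (Suc i)) \<in> P"
        unfolding f_def by (intro W.subspace_sum W.subspace_scale assms)
      moreover have "Sum_any f \<in> P"
        using l unfolding f_def .
      ultimately show ?thesis
        by (simp add: W.subspace_diff[OF assms(1)])
    qed
  qed
qed

lemma mode_in_mode_span: "v \<in> A \<Longrightarrow> w \<in> B \<Longrightarrow> YW v n w \<in> mode_span sW YW A B"
  unfolding mode_span_def by (intro W.span_base) blast

lemma subspace_mode_span: "W.subspace (mode_span sW YW A B)"
  unfolding mode_span_def by (rule W.subspace_span)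

lemma self_in_mode_span: "w \<in> mode_span sW YW UNIV {w}"
  using mode_in_mode_span[of vac UNIV w "{w}" "-1"] vacuum[of w] by simp

text \<open>Associativity: up to terms that \<open>mode_product_memI\<close> absorbs by induction,
  \<open>a_k b_n w\<close> is a combination of vectors \<open>(a_i b)_j w\<close>, which lie in
  \<open>V.w\<close>.\<close>

lemma mode_span_closed:
  assumes "x \<in> mode_span sW YW UNIV {w}"
  shows "YW a k x \<in> mode_span sW YW UNIV {w}" (is "_ \<in> ?P")
proof -
  have "YW a k (YW b n w) \<in> ?P" for b k n
  proof (rule mode_product_memI)
    show "W.subspace ?P" by (rule subspace_mode_span)
    fix k n
    obtain T where T: "\<And>n. n \<ge> T \<Longrightarrow> YW a n w = 0"
      using truncation by blast
    \<comment> \<open>With \<open>m = T\<close>, the second sum of the Jacobi identity involves only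
      \<open>a_j w\<close> with \<open>j \<ge> T\<close> and vanishes; this \<open>l\<close> gives
      \<open>m + l = k\<close>, the index of the leading mode.\<close>
    define l where "l = k - T"
    have "Sum_any (\<lambda>i::nat. sW ((-1) ^ i * (of_int l gchoose i))
            (YW a (T + l - int i) (YW b (n + int i) w)))
        = Sum_any (\<lambda>i::nat. sW (of_int T gchoose i) (YW (Y a (l + int i) b) (T + n - int i) w))"
      using jacobi_eq[of l a T b n w] by (simp add: T mode.zero)
    also have "\<dots> \<in> ?P"
      unfolding Sum_any.expand_set
      by (intro W.subspace_sum[OF subspace_mode_span] W.subspace_scale[OF subspace_mode_span]
          mode_in_mode_span) auto
    finally show "\<exists>l. Sum_any (\<lambda>i::nat. sW ((-1) ^ i * (of_int l gchoose i))
        (YW a (k - int i) (YW b (n + int i) w))) \<in> ?P"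
      by (intro exI[of _ l]) (simp add: l_def)
  qed
  then have "{YW v n w |v n. True} \<subseteq> {x. YW a k x \<in> ?P}"
    by blast
  moreover have "W.subspace {x. YW a k x \<in> ?P}"
    by (rule mode.subspace_vimage[OF subspace_mode_span, unfolded vimage_def])
  ultimately have "?P \<subseteq> {x. YW a k x \<in> ?P}"
    by (subst (1) mode_span_def) (intro W.span_minimal, auto)
  then show ?thesis
    using assms by blast
qed

text \<open>Commutativity: for \<open>l = L\<close> beyond the truncation bound of \<open>a\<close>
  on \<open>b\<close>, the right-hand side of the Jacobi identity vanishes, and the sum in which
  \<open>a\<close> acts on \<open>w\<close> first vanishes by hypothesis. The remaining sum is zero,
  so \<open>mode_product_memI\<close> applies to the zero subspace.\<close>

lemma annihilator_commutes:
  assumes "\<And>n. YW a n w = 0"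
  shows "YW a k (YW b n w) = 0"
proof -
  obtain L where L: "\<And>n. n \<ge> L \<Longrightarrow> Y a n b = 0"
    using V.truncation by blast
  have "YW a k (YW b n w) \<in> {0}"
  proof (rule mode_product_memI)
    show "\<exists>l. Sum_any (\<lambda>i::nat. sW ((-1) ^ i * (of_int l gchoose i))
        (YW a (k - int i) (YW b (n + int i) w))) \<in> {0}" for k n
      using jacobi_eq[of L a "k - L" b n w]
      by (intro exI[of _ L]) (simp add: assms L mode.zero state.zero)
  qed auto
  then show ?thesis by simp
qed

end

section \<open>Irreducible modules and Schur's lemma\<close>

locale irreducible_full_weak_module = full_weak_module +
  assumes nonzero: "\<exists>w::'b. w \<noteq> 0"
    and irreducible: "\<And>U. W.subspace U \<Longrightarrow> (\<And>a n u. u \<in> U \<Longrightarrow> YW a n u \<in> U) \<Longrightarrow> U = {0} \<or> U = UNIV"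
begin

lemma mode_span_eq_UNIV: "w \<noteq> 0 \<Longrightarrow> mode_span sW YW UNIV {w} = UNIV"
  using irreducible[OF subspace_mode_span, of UNIV "{w}"] mode_span_closed self_in_mode_span by blast

text \<open>The kernel of \<open>a_k\<close> contains all generators \<open>b_n w\<close> of
  \<open>V.w = W\<close>. In contrapositive form: a vector of \<open>V\<close> that acts
  nontrivially somewhere on \<open>W\<close> acts nontrivially on every nonzero element.\<close>

lemma annihilator_eq_0:
  assumes "\<And>n. YW a n w = 0" "w \<noteq> 0"
  shows "YW a k x = 0"
proof -
  have "mode_span sW YW UNIV {w} \<subseteq> {x. YW a k x = 0}"
    unfolding mode_span_def using annihilator_commutes assms(1)
    by (intro W.span_minimal mode.subspace_kernel) auto
  then show ?thesis
    by (auto simp: mode_span_eq_UNIV assms)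
qed

text \<open>Dixmier's argument provides a \<open>c\<close> for which \<open>T - c\<close> is not
  injective or not surjective. Kernel and image of \<open>T - c\<close> are submodules, so
  irreducibility forces \<open>T - c = 0\<close> in either case.\<close>

lemma schur:
  assumes "countable B" "V.span B = UNIV"
    and linear: "Vector_Spaces.linear sW sW T" and commutes: "\<And>a n w. T (YW a n w) = YW a n (T w)"
  shows "\<exists>c. \<forall>w. T w = sW c w"
proof -
  interpret T: complex_operator sW T
    by unfold_locales (use linear in \<open>auto simp: Vector_Spaces.linear_def module_hom_def module_hom_axioms_def\<close>)
  obtain w :: 'b where "w \<noteq> 0"
    using nonzero by blast
  \<comment> \<open>Since \<open>W = V.w\<close>, the modes of a countable spanning set of
    \<open>V\<close>, applied to \<open>w\<close>, span \<open>W\<close>.\<close>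
  define C where "C = (\<lambda>(b, n). YW b n w) ` (B \<times> UNIV)"
  have "countable C"
    unfolding C_def using assms by auto
  have "YW v n w \<in> W.span C" for v n
  proof -
    have "v \<in> V.span B" using assms by simp
    then show ?thesis
    proof (induction rule: V.span_induct_alt)
      case base
      then show ?case by (simp add: state.zero W.span_zero)
    next
      case (step c b y)
      then have "YW b n w \<in> C" by (auto simp: C_def)
      with step show ?case
        by (simp add: state.add state.scale W.span_add W.span_scale W.span_base)
    qed
  qed
  then have "mode_span sW YW UNIV {w} \<subseteq> W.span C"
    unfolding mode_span_def by (intro W.span_minimal) auto
  then have "W.span C = UNIV"
    using mode_span_eq_UNIV[OF \<open>w \<noteq> 0\<close>] by auto
  then obtain c where c: "(\<exists>x. x \<noteq> 0 \<and> T x = sW c x) \<or> (\<forall>x. T x \<noteq> sW c x + w)"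
    using T.exists_singular_value[OF \<open>countable C\<close>] \<open>w \<noteq> 0\<close> by blast
  define D where "D x = T x - sW c x" for x
  have "Vector_Spaces.linear sW sW D"
    by unfold_locales (auto simp: D_def T.T.add T.T.scale W.scale_right_distrib W.scale_right_diff_distrib
        W.scale_left_commute[of c])
  then interpret D: Vector_Spaces.linear sW sW D .
  let ?K = "{x. D x = 0}" and ?R = "range D"
  have D_mode: "D (YW a n x) = YW a n (D x)" for a n x
    by (simp add: D_def commutes mode.diff mode.scale)
  have K: "?K = {0} \<or> ?K = UNIV"
    by (rule irreducible) (auto simp: D.subspace_kernel D_mode mode.zero)
  have R: "?R = {0} \<or> ?R = UNIV"
  proof (rule irreducible)
    show "W.subspace ?R"
      by (intro D.subspace_image W.subspace_UNIV)
    show "YW a n u \<in> ?R" if "u \<in> ?R" for a n u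
      using that by (auto simp flip: D_mode)
  qed
  from c have "D = (\<lambda>x. 0)"
  proof
    assume "\<exists>x. x \<noteq> 0 \<and> T x = sW c x"
    then have "?K \<noteq> {0}"
      by (auto simp: D_def)
    with K have "?K = UNIV" by blast
    then show ?thesis by blast
  next
    assume *: "\<forall>x. T x \<noteq> sW c x + w"
    have "w \<noteq> D x" for x
      using *[rule_format, of x] by (auto simp: D_def)
    then have "?R = {0}"
      using R by (metis rangeE UNIV_I)
    then show ?thesis by blast
  qed
  then have "T x - sW c x = 0" for x
    using D_def[of x] by simp
  then show ?thesis
    by (simp add: exI[of _ c])
qed

end

section \<open>The module structure on \<open>W \<oplus> W\<close>\<close>

lemma Sum_any_Pair:
  fixes f :: "'i \<Rightarrow> 'a::comm_monoid_add" and h :: "'i \<Rightarrow> 'b::comm_monoid_add"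
  assumes "finite {i. f i \<noteq> 0}" "finite {i. h i \<noteq> 0}"
  shows "Sum_any (\<lambda>i. (f i, h i)) = (Sum_any f, Sum_any h)"
proof -
  let ?I = "{i. f i \<noteq> 0} \<union> {i. h i \<noteq> 0}"
  have "Sum_any (\<lambda>i. (f i, h i)) = (\<Sum>i\<in>?I. (f i, h i))"
    "Sum_any f = sum f ?I" "Sum_any h = sum h ?I"
    using assms by (intro Sum_any.expand_superset; auto simp: zero_prod_def)+
  then show ?thesis
    by (simp add: sum_prod)
qed

definition prod_scale :: "(complex \<Rightarrow> 'a \<Rightarrow> 'a) \<Rightarrow> complex \<Rightarrow> 'a \<times> 'a \<Rightarrow> 'a \<times> 'a" where
  "prod_scale s c = map_prod (s c) (s c)"

definition prod_mode :: "('v \<Rightarrow> int \<Rightarrow> 'a \<Rightarrow> 'a) \<Rightarrow> 'v \<Rightarrow> int \<Rightarrow> 'a \<times> 'a \<Rightarrow> 'a \<times> 'a" where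
  "prod_mode YW v n = map_prod (YW v n) (YW v n)"

lemma prod_scale_Pair [simp]: "prod_scale s c (x, y) = (s c x, s c y)"
  by (simp add: prod_scale_def)

lemma prod_mode_Pair [simp]: "prod_mode YW v n (x, y) = (YW v n x, YW v n y)"
  by (simp add: prod_mode_def)

context full_weak_module
begin

text \<open>\<open>Sum_any\<close> takes the value \<open>0\<close> on infinite support, so the sums
  of the Jacobi identity are split into components by means of their finite supports.\<close>

lemma finite_support_product:
  "finite {i::nat. sW (c i) (YW a (m - int i) (YW b (n + int i) w)) \<noteq> 0}"
proof -
  obtain N where N: "\<And>n. n \<ge> N \<Longrightarrow> YW b n w = 0"
    using truncation by blast
  have "sW (c i) (YW a (m - int i) (YW b (n + int i) w)) = 0" if "nat (N - n) \<le> i" for i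
    using that by (simp add: N mode.zero)
  then have "{i. sW (c i) (YW a (m - int i) (YW b (n + int i) w)) \<noteq> 0} \<subseteq> {..<nat (N - n)}"
    unfolding lessThan_def by (intro Collect_mono) (metis not_le)
  then show ?thesis
    by (rule finite_subset) simp
qed

lemma finite_support_iterate:
  "finite {i::nat. sW (c i) (YW (Y a (l + int i) b) (m - int i) w) \<noteq> 0}"
proof -
  obtain N where N: "\<And>n. n \<ge> N \<Longrightarrow> Y a n b = 0"
    using V.truncation by blast
  have "sW (c i) (YW (Y a (l + int i) b) (m - int i) w) = 0" if "nat (N - l) \<le> i" for i
    using that by (simp add: N state.zero)
  then have "{i. sW (c i) (YW (Y a (l + int i) b) (m - int i) w) \<noteq> 0} \<subseteq> {..<nat (N - l)}"
    unfolding lessThan_def by (intro Collect_mono) (metis not_le)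
  then show ?thesis
    by (rule finite_subset) simp
qed

lemma full_weak_module_product:
  "full_weak_module sV Y vac (prod_scale sW) (prod_mode YW)"
proof -
  interpret P: vector_space "prod_scale sW"
    by unfold_locales (auto simp: W.scale_right_distrib W.scale_left_distrib)
  have "jacobi_identity Y UNIV (prod_scale sW) (prod_mode YW) UNIV"
    unfolding jacobi_identity_def
  proof (intro ballI allI, goal_cases)
    case (1 a b w l m n)
    obtain x y where "w = (x, y)" by fastforce
    then show ?case
      using jacobi_eq[of l a m b n x] jacobi_eq[of l a m b n y]
      by (simp only: prod_scale_Pair prod_mode_Pair diff_Pair
          Sum_any_Pair[OF finite_support_product finite_support_product]
          Sum_any_Pair[OF finite_support_iterate finite_support_iterate])
  qed
  moreover have "\<exists>N. \<forall>n\<ge>N. prod_mode YW a n w = 0" for a w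
  proof -
    obtain x y where w: "w = (x, y)" by fastforce
    obtain M N where "\<And>n. n \<ge> M \<Longrightarrow> YW a n x = 0" "\<And>n. n \<ge> N \<Longrightarrow> YW a n y = 0"
      using truncation by (metis UNIV_I)
    then show ?thesis
      by (intro exI[of _ "max M N"]) (simp add: w zero_prod_def)
  qed
  ultimately show ?thesis
    by unfold_locales
      (auto simp: V.vertex_subalgebra_def add_left scale_left mode.add mode.scale vacuum zero_prod_def)
qed

lemma weak_module_restrict:
  assumes "V.vertex_subalgebra A" "W.subspace M" "\<And>a n w. a \<in> A \<Longrightarrow> w \<in> M \<Longrightarrow> YW a n w \<in> M"
  shows "weak_module sV Y vac A sW YW M"
  using assms jacobi
  by unfold_locales
    (auto simp: add_left scale_left mode.add mode.scale vacuum truncation jacobi_identity_def)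

end

section \<open>Compatible gradings of \<open>V\<close> and \<open>W\<close> by operators of finite
  order\<close>

locale equivariant_module = full_weak_module +
  G: finite_order_operator sV g p + P: finite_order_operator sW \<Phi> p
  for g p \<Phi> +
  assumes equivariant: "\<Phi> (YW a n w) = YW (g a) n (\<Phi> w)"
    and g_mode: "g (Y a n b) = Y (g a) n (g b)"
begin

abbreviation VE :: "complex \<Rightarrow> 'a set" where "VE \<equiv> eigenspace sV g"
abbreviation WE :: "complex \<Rightarrow> 'b set" where "WE \<equiv> eigenspace sW \<Phi>"

text \<open>By surjectivity the vacuum is some \<open>g b\<close>. Applying \<open>g\<close> to the
  product of \<open>vac\<close> and \<open>b\<close> in mode \<open>-1\<close> gives
  \<open>g b\<close>, and by the creation property it also gives \<open>g vac\<close>.\<close>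

lemma g_vac: "g vac = vac"
proof -
  obtain b where b: "g b = vac"
    using G.funpow_order G.order_pos by (metis comp_apply funpow.simps(2) gr0_implies_Suc id_apply)
  have "g vac = Y (g vac) (-1) vac"
    by (simp add: V.creation)
  also have "\<dots> = g (Y vac (-1) b)"
    by (simp add: g_mode b)
  also have "\<dots> = vac"
    by (simp add: V.vacuum b)
  finally show ?thesis .
qed

lemma fixed_subalgebra_eq: "fixed_subalgebra g = VE 1"
  by (simp add: fixed_subalgebra_def eigenspace_def)

lemma vertex_subalgebra_fixed: "V.vertex_subalgebra (fixed_subalgebra g)"
  unfolding V.vertex_subalgebra_def
  using G.subspace_eigenspace[of 1]
  by (auto simp: fixed_subalgebra_eq eigenspace_def g_vac g_mode)

lemma mode_eigenspace: "v \<in> VE c \<Longrightarrow> w \<in> WE d \<Longrightarrow> YW v n w \<in> WE (c * d)"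
  by (auto simp: eigenspace_def equivariant scale_left mode.scale)

lemma mode_span_eigenspace: "mode_span sW YW (VE c) (WE d) \<subseteq> WE (c * d)"
  unfolding mode_span_def
  by (intro W.span_minimal P.subspace_eigenspace) (auto intro: mode_eigenspace)

lemma weak_module_eigenspace: "weak_module sV Y vac (fixed_subalgebra g) sW YW (WE d)"
  using mode_eigenspace[of _ 1]
  by (intro weak_module_restrict vertex_subalgebra_fixed P.subspace_eigenspace)
    (auto simp: fixed_subalgebra_eq)

text \<open>Equivariance makes \<open>\<Phi> ^^ k\<close> act on \<open>v\<close> through
  \<open>g ^^ k\<close> and on \<open>w\<close> by the scalar \<open>d ^ k\<close>, so the weight
  \<open>e\<close> of the average turns into \<open>e / d\<close>.\<close>

lemma proj_mode:
  assumes "w \<in> WE d"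
  shows "P.proj e (YW v n w) = YW (G.proj (e / d) v) n w"
proof -
  have "(\<Phi> ^^ k) (YW v n w) = YW ((g ^^ k) v) n ((\<Phi> ^^ k) w)" for k
    by (induction k) (auto simp: equivariant)
  then have "(\<Phi> ^^ k) (YW v n w) = sW (d ^ k) (YW ((g ^^ k) v) n w)" for k
    using assms P.funpow_eigenvector[of w d k] by (simp add: eigenspace_def mode.scale)
  then show ?thesis
    by (simp add: P.proj_def G.proj_def state.scale state.sum divide_inverse power_mult_distrib)
qed

lemma proj_mode_span:
  assumes "w \<in> WE d" "d ^ p = 1" "e ^ p = 1" "x \<in> mode_span sW YW UNIV {w}"
  shows "P.proj e x \<in> mode_span sW YW (VE (e / d)) {w}" (is "_ \<in> ?S")
proof -
  have "YW v n w \<in> {x. P.proj e x \<in> ?S}" for v n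
    using assms
    by (auto simp: proj_mode power_divide intro!: mode_in_mode_span G.proj_in_eigenspace)
  moreover have "W.subspace {x. P.proj e x \<in> ?S}"
    by (rule P.proj.subspace_vimage[OF subspace_mode_span, unfolded vimage_def])
  ultimately have "mode_span sW YW UNIV {w} \<subseteq> {x. P.proj e x \<in> ?S}"
    by (subst (1) mode_span_def) (intro W.span_minimal, auto)
  then show ?thesis
    using assms by blast
qed

text \<open>Projection to degree \<open>e\<close> fixes \<open>x\<close> and turns each generator
  \<open>v_n w\<close> of \<open>V.w\<close> into one with \<open>v\<close> of degree
  \<open>e / d\<close>. It is applied both to \<open>W\<close> and to the reducible module
  \<open>W \<oplus> W\<close>.\<close>

lemma eigenspace_generated:
  assumes "w \<in> WE d" "d ^ p = 1" "e ^ p = 1" "x \<in> mode_span sW YW UNIV {w}" "x \<in> WE e"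
  shows "x \<in> mode_span sW YW (VE (e / d)) {w}"
  using proj_mode_span[OF assms(1-4)] assms P.proj_eigenvector[of x e e]
  by (simp add: eigenspace_def)

end

context equivariant_module
begin

text \<open>The two scalars normalise degrees: the sum of the \<open>d\<close>-eigenspace in the
  first component and the \<open>e\<close>-eigenspace in the second becomes the eigenspace for
  \<open>1\<close>.\<close>

lemma equivariant_module_product:
  assumes "d ^ p = 1" "e ^ p = 1"
  shows "equivariant_module sV Y vac (prod_scale sW) (prod_mode YW) g p
    (\<lambda>(x, y). (sW (inverse d) (\<Phi> x), sW (inverse e) (\<Phi> y)))"
proof -
  interpret M: full_weak_module sV Y vac "prod_scale sW" "prod_mode YW"
    by (rule full_weak_module_product)
  let ?\<Psi> = "\<lambda>(x, y). (sW (inverse d) (\<Phi> x), sW (inverse e) (\<Phi> y))"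
  have linear: "Vector_Spaces.linear (prod_scale sW) (prod_scale sW) ?\<Psi>"
    by unfold_locales
      (auto simp: P.T.add P.T.scale W.scale_right_distrib mult.commute)
  have funpow: "(?\<Psi> ^^ k) (x, y) = (sW (inverse d ^ k) ((\<Phi> ^^ k) x), sW (inverse e ^ k) ((\<Phi> ^^ k) y))"
    for k x y
    by (induction k) (simp_all add: P.T.scale)
  have "inverse d ^ p = 1" "inverse e ^ p = 1"
    using assms by (simp_all add: power_inverse)
  then have "(?\<Psi> ^^ p) u = u" for u
    by (cases u) (simp only: funpow P.funpow_order id_apply W.scale_one)
  then have "?\<Psi> ^^ p = id"
    by (intro ext) (simp only: id_apply)
  then interpret Q: finite_order_operator "prod_scale sW" ?\<Psi> p
    using finite_order_operator.intro[OF
        complex_operator.intro[OF M.W.vector_space_axioms complex_operator_axioms.intro[OF linear]]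
        finite_order_operator_axioms.intro[OF P.order_pos]]
    by blast
  have "?\<Psi> (prod_mode YW a n u) = prod_mode YW (g a) n (?\<Psi> u)" for a n u
    by (cases u) (simp add: equivariant mode.scale)
  then show ?thesis
    by (intro equivariant_module.intro equivariant_module_axioms.intro M.full_weak_module_axioms
        G.finite_order_operator_axioms Q.finite_order_operator_axioms g_mode)
qed

end

section \<open>Irreducibility and inequivalence of the eigenspaces over the fixed subalgebra\<close>

locale irreducible_equivariant_module = equivariant_module + irreducible_full_weak_module
begin

lemma eigenspace_subset:
  assumes "x \<in> WE e" "w \<in> WE d" "w \<noteq> 0" "d ^ p = 1" "e ^ p = 1"
  shows "x \<in> mode_span sW YW (VE (e / d)) {w}"
  using assms by (intro eigenspace_generated) (auto simp: mode_span_eq_UNIV)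

lemma irreducible_eigenspace:
  assumes "d ^ p = 1" "WE d \<noteq> {0}"
  shows "irreducible_weak_module sV Y vac (fixed_subalgebra g) sW YW (WE d)"
  unfolding irreducible_weak_module_def
proof (intro conjI allI impI assms weak_module_eigenspace)
  fix U assume U: "W.subspace U \<and> U \<subseteq> WE d \<and> (\<forall>a\<in>fixed_subalgebra g. \<forall>n. \<forall>u\<in>U. YW a n u \<in> U)"
  show "U = {0} \<or> U = WE d"
  proof (cases "U = {0}")
    case False
    then obtain w where w: "w \<in> U" "w \<noteq> 0"
      using U W.subspace_0 by blast
    \<comment> \<open>The form \<open>d / d\<close> is that of \<open>eigenspace_subset\<close>; its
      value is \<open>1\<close>, and the eigenspace of \<open>g\<close> for \<open>1\<close> is the
      fixed subalgebra.\<close>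
    have "mode_span sW YW (VE (d / d)) {w} \<subseteq> U"
      unfolding mode_span_def using U w assms P.root_nonzero[of d]
      by (intro W.span_minimal) (auto simp: fixed_subalgebra_eq)
    then have "WE d \<subseteq> U"
      using eigenspace_subset[of _ d w d] U w assms by blast
    with U show ?thesis by blast
  qed simp
qed

text \<open>An isomorphism \<open>f\<close> extends to a \<open>V\<close>-endomorphism of \<open>W\<close>: the \<open>V\<close>-submodule of \<open>W \<oplus> W\<close>
  generated by \<open>(w, f w)\<close> meets \<open>W\<^sup>i \<oplus> W\<^sup>j\<close> only in the graph of \<open>f\<close>, hence is itself a graph.
  By Schur's lemma, the endomorphism is a scalar, so it cannot map \<open>W\<^sup>i\<close> to \<open>W\<^sup>j\<close>.\<close>

lemma eigenspaces_not_isomorphic: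
  assumes "countable B" "V.span B = UNIV"
    and roots: "d ^ p = 1" "e ^ p = 1" "d \<noteq> e" and "WE d \<noteq> {0}"
  shows "\<not> isomorphic_weak_modules (fixed_subalgebra g) sW YW (WE d) sW YW (WE e)"
proof
  assume "isomorphic_weak_modules (fixed_subalgebra g) sW YW (WE d) sW YW (WE e)"
  then obtain f where bij: "bij_betw f (WE d) (WE e)"
    and f_add: "\<And>x y. x \<in> WE d \<Longrightarrow> y \<in> WE d \<Longrightarrow> f (x + y) = f x + f y"
    and f_scale: "\<And>c x. x \<in> WE d \<Longrightarrow> f (sW c x) = sW c (f x)"
    and f_mode: "\<And>a n x. a \<in> fixed_subalgebra g \<Longrightarrow> x \<in> WE d \<Longrightarrow> f (YW a n x) = YW a n (f x)"
    unfolding isomorphic_weak_modules_def by blast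
  have zero: "0 \<in> WE c" for c
    by (rule W.subspace_0[OF P.subspace_eigenspace])
  have f0: "f 0 = 0"
    using f_scale[OF zero, of 0] by simp
  obtain w where w: "w \<in> WE d" "w \<noteq> 0"
    using assms zero by blast
  have fw: "f w \<in> WE e" "f w \<noteq> 0"
    using bij w zero f0 by (auto simp: bij_betw_def dest: inj_onD[of f "WE d" w 0])
  let ?\<Psi> = "\<lambda>(x, y). (sW (inverse d) (\<Phi> x), sW (inverse e) (\<Phi> y))"
  interpret M: equivariant_module sV Y vac "prod_scale sW" "prod_mode YW" g p ?\<Psi>
    by (rule equivariant_module_product) (use roots in auto)
  have nz: "d \<noteq> 0" "e \<noteq> 0"
    using roots by (auto dest: P.root_nonzero)
  have fixed: "(x, y) \<in> eigenspace (prod_scale sW) ?\<Psi> 1" if "x \<in> WE d" "y \<in> WE e" for x y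
    using that nz by (simp add: eigenspace_def)
  define C where "C = mode_span (prod_scale sW) (prod_mode YW) UNIV {(w, f w)}"
  have sub: "M.W.subspace C"
    unfolding C_def by (rule M.subspace_mode_span)
  have C_mode: "(YW a n x, YW a n y) \<in> C" if "(x, y) \<in> C" for a n x y
    using M.mode_span_closed[of "(x, y)" "(w, f w)" a n] that by (simp add: C_def)
  have C_add: "(x + x', y + y') \<in> C" if "(x, y) \<in> C" "(x', y') \<in> C" for x y x' y'
    using M.W.subspace_add[OF sub that] by simp
  have C_scale: "(sW c x, sW c y) \<in> C" if "(x, y) \<in> C" for c x y
    using M.W.subspace_scale[OF sub that, of c] by simp
  have C_0: "(0, 0) \<in> C"
    using M.W.subspace_0[OF sub] by (simp add: zero_prod_def)
  have C_w: "(w, f w) \<in> C"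
    unfolding C_def by (rule M.self_in_mode_span)
  have graph: "y = f x" if "(x, y) \<in> C" "x \<in> WE d" "y \<in> WE e" for x y
  proof -
    let ?G = "{(x, f x) | x. x \<in> WE d}"
    have "(x, y) \<in> mode_span (prod_scale sW) (prod_mode YW) (VE (1 / 1)) {(w, f w)}"
      using that w fw by (intro M.eigenspace_generated fixed) (auto simp: C_def)
    also have "\<dots> \<subseteq> ?G"
      unfolding mode_span_def
    proof (rule M.W.span_minimal)
      show "M.W.subspace ?G"
        using P.subspace_eigenspace[of d] zero[of d]
        by (auto simp: M.W.subspace_def W.subspace_def zero_prod_def f0 f_add f_scale)
      show "{prod_mode YW v n u |v n u. v \<in> VE (1 / 1) \<and> u \<in> {(w, f w)}} \<subseteq> ?G"
        using f_mode w mode_eigenspace[of _ 1 w d] by (auto simp: fixed_subalgebra_eq)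
    qed
    finally show ?thesis by auto
  qed
  \<comment> \<open>The fibre of \<open>C\<close> over \<open>0\<close> is a submodule of
    \<open>W\<close>. It misses \<open>f w\<close>, since \<open>graph\<close> would give
    \<open>f w = f 0 = 0\<close>; hence it is zero and \<open>C\<close> is single-valued.\<close>
  have N: "{y. (0, y) \<in> C} = {0} \<or> {y. (0, y) \<in> C} = UNIV"
  proof (rule irreducible)
    show "W.subspace {y. (0, y) \<in> C}"
      using C_0 C_add[of 0 _ 0] C_scale[of 0] by (auto simp: W.subspace_def)
    show "YW a n u \<in> {y. (0, y) \<in> C}" if "u \<in> {y. (0, y) \<in> C}" for a n u
      using that C_mode[of 0 u a n] by (simp add: mode.zero)
  qed
  have "f w \<notin> {y. (0, y) \<in> C}"
    using graph[of 0 "f w"] zero fw f0 by auto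
  with N have N: "y = 0" if "(0, y) \<in> C" for y
    using that by blast
  have unique: "y = y'" if "(x, y) \<in> C" "(x, y') \<in> C" for x y y'
    using N[of "y - y'"] M.W.subspace_diff[OF sub that] by simp
  \<comment> \<open>The domain of \<open>C\<close> is a submodule containing \<open>w\<close>, so
    \<open>C\<close> is the graph of a map on all of \<open>W\<close>.\<close>
  have "{x. \<exists>y. (x, y) \<in> C} = {0} \<or> {x. \<exists>y. (x, y) \<in> C} = UNIV"
  proof (rule irreducible)
    show "W.subspace {x. \<exists>y. (x, y) \<in> C}"
      using C_0 C_add C_scale unfolding W.subspace_def by blast
    show "YW a n u \<in> {x. \<exists>y. (x, y) \<in> C}" if "u \<in> {x. \<exists>y. (x, y) \<in> C}" for a n u
      using that C_mode by blast
  qed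
  then have "{x. \<exists>y. (x, y) \<in> C} = UNIV"
    using C_w w by blast
  then have "\<forall>x. \<exists>y. (x, y) \<in> C"
    by blast
  then obtain F where F: "\<And>x. (x, F x) \<in> C"
    by metis
  have "F (x + y) = F x + F y" "F (sW c x) = sW c (F x)" "F (YW a n x) = YW a n (F x)" for x y c a n
    using unique[OF F C_add[OF F F]] unique[OF F C_scale[OF F]] unique[OF F C_mode[OF F]]
    by auto
  then obtain c where "\<And>x. F x = sW c x"
    using schur[OF assms(1,2), of F]
    by (auto simp: Vector_Spaces.linear_def module_hom_def module_hom_axioms_def
        W.vector_space_axioms W.module_axioms)
  then have "f w = sW c w"
    using unique[OF C_w F] by simp
  then have "f w \<in> WE d"
    using w W.subspace_scale[OF P.subspace_eigenspace] by simp
  with fw have "sW d (f w) = sW e (f w)"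
    by (simp add: eigenspace_def)
  with fw roots show False
    by simp
qed

end

section \<open>Nonvanishing of all eigenspaces\<close>

lemma nat_submonoid_multiples:
  fixes X :: "nat set"
  assumes "p \<in> X" "p > 0"
    and add: "\<And>m n. m \<in> X \<Longrightarrow> n \<in> X \<Longrightarrow> m + n \<in> X"
    and periodic: "\<And>m n. m + p * n \<in> X \<Longrightarrow> m \<in> X"
  obtains d where "d > 0" "\<And>n. n \<in> X \<longleftrightarrow> d dvd n"
proof -
  \<comment> \<open>Modulo \<open>p\<close>, the set \<open>X\<close> is a subgroup of a finite
    cyclic group; its least positive element generates it.\<close>
  define d where "d = (LEAST n. n > 0 \<and> n \<in> X)"
  have d: "d > 0" "d \<in> X"
    using LeastI[of "\<lambda>n. n > 0 \<and> n \<in> X" p] assms(1,2) unfolding d_def by blast+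
  have least: "\<not> (m > 0 \<and> m \<in> X)" if "m < d" for m
    using that unfolding d_def by (rule not_less_Least)
  have "0 \<in> X"
    using periodic[of 0 1] assms(1) by simp
  then have mult: "k * d \<in> X" for k
    by (induction k) (auto intro: add d)
  have "d dvd n" if "n \<in> X" for n
  proof -
    obtain q where q: "p = Suc q"
      using gr0_implies_Suc[OF assms(2)] by blast
    \<comment> \<open>Modulo \<open>p\<close>, subtracting \<open>n div d * d\<close> from
      \<open>n\<close> amounts to adding \<open>p - 1\<close> times that number, which stays within
      \<open>X\<close>.\<close>
    have "n mod d + p * (n div d * d) = n mod d + n div d * d + q * (n div d) * d"
      unfolding q by (simp add: mult.assoc)
    also have "\<dots> = n + q * (n div d) * d"
      by (simp only: mod_div_mult_eq)
    also have "\<dots> \<in> X"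
      by (intro add that mult)
    finally have "n mod d \<in> X"
      by (rule periodic)
    then have "\<not> n mod d > 0"
      using least[of "n mod d"] mod_less_divisor[OF d(1)] by simp
    then have "n mod d = 0" by simp
    then show ?thesis by (simp add: dvd_eq_mod_eq_0)
  qed
  then have "n \<in> X \<longleftrightarrow> d dvd n" for n
    using mult[of "n div d"] by (metis dvd_div_mult_self)
  with d(1) show ?thesis
    by (rule that)
qed

context irreducible_equivariant_module
begin

text \<open>The exponents \<open>i\<close> for which \<open>V\<^sup>i\<close> acts nontrivially are the multiples of some \<open>d\<close> dividing
  \<open>p\<close>; then \<open>g\<^bsup>p/d\<^esup>\<close> acts trivially modulo the annihilator of \<open>W\<close>, so \<open>d = 1\<close>.\<close>

lemma eigenspace_nonzero:
  assumes prim: "primitive_root_of_unity p \<zeta>"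
    and faithful: "\<And>k. 0 < k \<Longrightarrow> k < p \<Longrightarrow> \<exists>v n w. YW ((g ^^ k) v) n w \<noteq> YW v n w"
  shows "WE (\<zeta> ^ i) \<noteq> {0}"
proof -
  have \<zeta>p: "\<zeta> ^ p = 1"
    using prim by (simp add: primitive_root_of_unity_def)
  note root = primitive_root_power_eq_1[OF prim]
  define acts where "acts c \<longleftrightarrow> (\<exists>v\<in>VE c. \<exists>n w. YW v n w \<noteq> 0)" for c
  have shift: "\<exists>y\<in>WE (c * d). y \<noteq> 0" if *: "acts c" "x \<in> WE d" "x \<noteq> 0" for c d x
  proof -
    obtain v n w where v: "v \<in> VE c" "YW v n w \<noteq> 0"
      using *(1) unfolding acts_def by blast
    then obtain m where "YW v m x \<noteq> 0"
      using annihilator_eq_0[of v x n w] *(3) by blast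
    with v *(2) show ?thesis
      using mode_eigenspace by blast
  qed
  \<comment> \<open>This is the converse of \<open>shift\<close>: by irreducibility every vector of
    degree \<open>c * d\<close> arises from \<open>x\<close> through vectors of \<open>V\<close> of
    degree \<open>c\<close>.\<close>
  have acts: "acts c"
    if "c ^ p = 1" "d ^ p = 1" "x \<in> WE d" "x \<noteq> 0" "y \<in> WE (c * d)" "y \<noteq> 0" for c d x y
  proof (rule ccontr)
    assume "\<not> acts c"
    then have "mode_span sW YW (VE c) {x} \<subseteq> {0}"
      unfolding mode_span_def acts_def by (intro W.span_minimal) auto
    moreover have "y \<in> mode_span sW YW (VE (c * d / d)) {x}"
      using that by (intro eigenspace_subset) (auto simp: power_mult_distrib)
    ultimately show False
      using that P.root_nonzero[of d] by auto
  qed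
  obtain a x where x: "x \<in> WE (\<zeta> ^ a)" "x \<noteq> 0"
  proof -
    obtain x0 :: 'b where "x0 \<noteq> 0"
      using nonzero by blast
    then obtain a where "P.proj (\<zeta> ^ a) x0 \<noteq> 0"
      using P.sum_proj[OF prim, of x0] by (metis sum.neutral)
    then show ?thesis
      using that P.proj_in_eigenspace[OF root] by blast
  qed
  obtain d where d: "d > 0" "\<And>n. acts (\<zeta> ^ n) \<longleftrightarrow> d dvd n"
  proof (rule nat_submonoid_multiples[of p "{n. acts (\<zeta> ^ n)}"])
    show "p \<in> {n. acts (\<zeta> ^ n)}"
      using acts[where c = 1 and y = x, OF _ root x] x by (simp add: \<zeta>p)
    show "m \<in> {n. acts (\<zeta> ^ n)}" if "m + p * n \<in> {n. acts (\<zeta> ^ n)}" for m n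
      using that by (simp add: power_add power_mult \<zeta>p)
    show "m + n \<in> {n. acts (\<zeta> ^ n)}" if *: "m \<in> {n. acts (\<zeta> ^ n)}" "n \<in> {n. acts (\<zeta> ^ n)}" for m n
    proof -
      obtain y where "y \<in> WE (\<zeta> ^ n * \<zeta> ^ a)" "y \<noteq> 0"
        using shift[OF _ x] *(2) by blast
      then obtain z where "z \<in> WE (\<zeta> ^ m * (\<zeta> ^ n * \<zeta> ^ a))" "z \<noteq> 0"
        using shift *(1) by blast
      then show ?thesis
        using acts[where c = "\<zeta> ^ (m + n)" and y = z, OF root root x] by (simp add: power_add mult.assoc)
    qed
  qed (use P.order_pos in auto)
  have "d = 1"
  proof (rule ccontr)
    assume "d \<noteq> 1"
    have "acts (\<zeta> ^ p)"
      using acts[where c = 1 and y = x, OF _ root x] x by (simp add: \<zeta>p)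
    then obtain k where k: "p = d * k"
      using d by blast
    with P.order_pos \<open>d \<noteq> 1\<close> \<open>d > 0\<close> have "0 < k" "k < p"
      by (auto intro: Nat.gr0I)
    then obtain v n w where neq: "YW ((g ^^ k) v) n w \<noteq> YW v n w"
      using faithful by blast
    \<comment> \<open>If \<open>d\<close> divides \<open>i\<close>, then \<open>g ^^ k\<close> fixes
      \<open>u\<close>, as \<open>p = d * k\<close> divides \<open>i * k\<close>. Otherwise all
      modes of \<open>u\<close> vanish on \<open>W\<close>, and \<open>(g ^^ k) u\<close> is a
      multiple of \<open>u\<close>.\<close>
    have "YW ((g ^^ k) u) n w = YW u n w" if "u \<in> VE (\<zeta> ^ i)" for u i
    proof (cases "d dvd i")
      case True
      then obtain j where "i = d * j" by blast
      then have "(\<zeta> ^ i) ^ k = (\<zeta> ^ p) ^ j"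
        unfolding k by (simp add: mult_ac flip: power_mult)
      then show ?thesis
        using that G.funpow_eigenvector[of u "\<zeta> ^ i" k] by (simp add: eigenspace_def \<zeta>p)
    next
      case False
      then have "YW u n w = 0"
        using that d unfolding acts_def by blast
      then show ?thesis
        using that G.funpow_eigenvector[of u "\<zeta> ^ i" k] by (simp add: eigenspace_def state.scale)
    qed
    then have "YW ((g ^^ k) (\<Sum>i<p. G.proj (\<zeta> ^ i) v)) n w = YW (\<Sum>i<p. G.proj (\<zeta> ^ i) v) n w"
      using G.proj_in_eigenspace[OF root]
      by (simp only: G.funpow.sum state.sum) (intro sum.cong refl, blast)
    with neq show False
      by (simp add: G.sum_proj[OF prim])
  qed
  \<comment> \<open>Modulo \<open>p\<close> this is \<open>i - a\<close>, the degree that carries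
    \<open>W^a\<close> to \<open>W^i\<close>.\<close>
  define m where "m = i + (p - 1) * a"
  have "m + a = i + p * a"
    using P.order_pos by (cases p) (auto simp: m_def)
  then have "\<zeta> ^ m * \<zeta> ^ a = \<zeta> ^ i"
    by (metis \<zeta>p mult.right_neutral power_add power_mult power_one)
  moreover have "acts (\<zeta> ^ m)"
    using d \<open>d = 1\<close> by simp
  ultimately show ?thesis
    using shift[OF _ x, of "\<zeta> ^ m"] by auto
qed

end

section \<open>Rescaling the intertwiner and assembling the decomposition\<close>

lemma complex_nth_root_exists:
  fixes c :: complex
  assumes "p > 0"
  shows "\<exists>z. z ^ p = c"
proof -
  have "rcis (root p (cmod c)) (Arg c / real p) ^ p = rcis (cmod c) (Arg c)"
    using assms by (simp add: DeMoivre2)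
  then show ?thesis
    by (metis rcis_cmod_Arg)
qed

lemma (in vertex_operator_algebra) countable_spanning_set:
  obtains B where "countable B" "span B = UNIV"
proof -
  obtain B where B: "\<And>n. finite (B n)" "\<And>n. gr n = span (B n)"
    using grading_finite_dim by metis
  have "gr n \<subseteq> span (\<Union>n. B n)" for n
    unfolding B by (intro span_mono) blast
  then have "span (\<Union>n. gr n) \<subseteq> span (\<Union>n. B n)"
    by (intro span_minimal) auto
  then have "span (\<Union>n. B n) = UNIV"
    using grading by (auto simp: direct_sum_of_def)
  moreover have "countable (\<Union>n. B n)"
    using B by (intro countable_UN) (auto intro: countable_finite)
  ultimately show ?thesis
    using that by blast
qed

text \<open>Complete reducibility refers to a set of submodules; injectivity keeps the members of an
  indexed family from merging in that set.\<close>

lemma direct_sum_of_image: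
  assumes "direct_sum_of scale I U M" "inj_on U I"
  shows "direct_sum_of scale (U ` I) (\<lambda>X. X) M"
  unfolding direct_sum_of_def
proof (intro conjI allI impI)
  fix J x
  assume J: "finite J \<and> J \<subseteq> U ` I \<and> (\<forall>X\<in>J. x X \<in> X) \<and> sum x J = 0"
  then obtain K where K: "K \<subseteq> I" "finite K" "J = U ` K"
    by (meson finite_subset_image)
  have "inj_on U K"
    using assms(2) K(1) by (rule inj_on_subset)
  then have "(\<Sum>i\<in>K. x (U i)) = 0"
    using J unfolding K(3) by (simp add: sum.reindex)
  moreover have "\<forall>i\<in>K. x (U i) \<in> U i"
    using J unfolding K(3) by simp
  ultimately have "\<forall>i\<in>K. x (U i) = 0"
    using assms(1) K(1,2) unfolding direct_sum_of_def
    by (elim conjE allE[of _ K] allE[of _ "\<lambda>i. x (U i)"]) blast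
  then show "\<forall>X\<in>J. x X = 0"
    unfolding K(3) by simp
qed (use assms(1) in \<open>auto simp: direct_sum_of_def\<close>)

theorem theorem6p3:
  fixes sV :: "complex \<Rightarrow> 'v::ab_group_add \<Rightarrow> 'v"
    and Y :: "'v \<Rightarrow> int \<Rightarrow> 'v \<Rightarrow> 'v"
    and vac omega :: 'v
    and gr :: "int \<Rightarrow> 'v set"
    and g :: "'v \<Rightarrow> 'v"
    and p :: nat
    and \<zeta> :: complex
    and sW :: "complex \<Rightarrow> 'w::ab_group_add \<Rightarrow> 'w"
    and YW :: "'v \<Rightarrow> int \<Rightarrow> 'w \<Rightarrow> 'w"
  assumes "vertex_operator_algebra sV Y vac omega gr"
    and "voa_automorphism sV Y omega g"
    and "has_order g p"
    and "primitive_root_of_unity p \<zeta>"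
    and "irreducible_weak_module sV Y vac UNIV sW YW UNIV"
    and "isomorphic_weak_modules UNIV sW (twist g YW) UNIV sW YW UNIV"
    \<comment> \<open>\<open>W \<circ> g\<^sup>k\<close> is not literally \<open>W\<close> for \<open>0 < k < p\<close>: this follows from \<open>has_order g p\<close> when \<open>V\<close> is
      simple, and is a consequence of the conclusion; without it the conclusion fails for
      \<open>V = C[x]/(x\<^sup>2)\<close>, \<open>g x = -x\<close>, \<open>W = V/(x)\<close>\<close>
    and "\<forall>k. 0 < k \<and> k < p \<longrightarrow> twist (g ^^ k) YW \<noteq> YW"
  shows "completely_reducible_weak_module sV Y vac (fixed_subalgebra g) sW YW UNIV \<and>
    (\<exists>(\<Phi> :: 'w \<Rightarrow> 'w) (Wi :: nat \<Rightarrow> 'w set).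
       Vector_Spaces.linear sW sW \<Phi> \<and> bij \<Phi> \<and>
       (\<forall>v n w. \<Phi> (YW v n w) = YW (g v) n (\<Phi> w)) \<and>
       (\<forall>i<p. Wi i = eigenspace sW \<Phi> (\<zeta> ^ i)) \<and>
       direct_sum_of sW {..<p} Wi UNIV \<and>
       (\<forall>i<p. \<forall>j<p. mode_span sW YW (eigenspace sV g (\<zeta> ^ i)) (Wi j) \<subseteq> Wi ((i + j) mod p)) \<and>
       (\<forall>i<p. irreducible_weak_module sV Y vac (fixed_subalgebra g) sW YW (Wi i)) \<and>
       (\<forall>i<p. \<forall>j<p. i \<noteq> j \<longrightarrow>
          \<not> isomorphic_weak_modules (fixed_subalgebra g) sW YW (Wi i) sW YW (Wi j)))"
proof -
  interpret V: vertex_operator_algebra sV Y vac omega gr by fact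
  have irr: "weak_module sV Y vac UNIV sW YW UNIV" "UNIV \<noteq> {0::'w}"
    "\<And>U. module.subspace sW U \<Longrightarrow> (\<And>a n u. u \<in> U \<Longrightarrow> YW a n u \<in> U) \<Longrightarrow> U = {0} \<or> U = UNIV"
    using assms(5) unfolding irreducible_weak_module_def by blast+
  interpret weak_module sV Y vac UNIV sW YW UNIV by (rule irr)
  interpret M: irreducible_full_weak_module sV Y vac sW YW
  proof
    show "\<exists>w::'w. w \<noteq> 0" using irr(2) by blast
  qed (use irr(3) in blast)
  obtain B where B: "countable B" "V.span B = UNIV"
    by (rule V.countable_spanning_set)
  have g: "Vector_Spaces.linear sV sV g" "\<And>a n b. g (Y a n b) = Y (g a) n (g b)"
    using assms(2) by (auto simp: voa_automorphism_def)
  have p: "p > 0" "g ^^ p = id"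
    using assms(3) by (auto simp: has_order_def)
  obtain f where bij: "bij f"
    and f: "\<And>x y. f (x + y) = f x + f y" "\<And>c x. f (sW c x) = sW c (f x)"
      "\<And>a n x. f (YW (g a) n x) = YW a n (f x)"
    using assms(6) unfolding isomorphic_weak_modules_def twist_def by auto
  define h where "h = inv f"
  have fh: "f (h x) = x" "h (f x) = x" for x
    using bij by (auto simp: h_def bij_def surj_f_inv_f)
  have h: "h (x + y) = h x + h y" "h (sW c x) = sW c (h x)" "h (YW a n x) = YW (g a) n (h x)"
    for x y c a n
    by (metis f fh)+
  have "Vector_Spaces.linear sW sW h"
    by unfold_locales (auto simp: h)
  then interpret h: complex_operator sW h
    by (intro complex_operator.intro W.vector_space_axioms complex_operator_axioms.intro)
  have h_funpow: "(h ^^ k) (YW a n x) = YW ((g ^^ k) a) n ((h ^^ k) x)" for k a n x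
    by (induction k) (auto simp: h)
  \<comment> \<open>Because \<open>g ^^ p = id\<close>, the power \<open>h ^^ p\<close> commutes
    with all modes.\<close>
  obtain c where c: "\<And>w. (h ^^ p) w = sW c w"
    using M.schur[OF B h.linear_funpow[of p]] h_funpow[of p] p by auto
  have "inj (h ^^ p)"
    by (intro inj_fn inj_on_inverseI[of _ f]) (simp add: fh)
  have "c \<noteq> 0"
  proof
    assume "c = 0"
    obtain w :: 'w where "w \<noteq> 0" using irr(2) by blast
    moreover have "(h ^^ p) w = (h ^^ p) 0"
      unfolding c \<open>c = 0\<close> by simp
    ultimately show False
      using injD[OF \<open>inj (h ^^ p)\<close>, of w 0] by simp
  qed
  obtain z where z: "z ^ p = inverse c"
    using complex_nth_root_exists[OF p(1)] by blast
  then have "z \<noteq> 0"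
    using \<open>c \<noteq> 0\<close> p(1) by (auto simp: zero_power)
  define \<Phi> where "\<Phi> w = sW z (h w)" for w
  have linear: "Vector_Spaces.linear sW sW \<Phi>"
    by unfold_locales (auto simp: \<Phi>_def h W.scale_right_distrib mult.commute)
  have "(\<Phi> ^^ k) w = sW (z ^ k) ((h ^^ k) w)" for k w
    by (induction k) (auto simp: \<Phi>_def h)
  then have \<Phi>p: "\<Phi> ^^ p = id"
    using \<open>c \<noteq> 0\<close> by (simp add: fun_eq_iff c z)
  have equivariant: "\<Phi> (YW a n w) = YW (g a) n (\<Phi> w)" for a n w
    by (simp add: \<Phi>_def h M.mode.scale)
  interpret G: finite_order_operator sV g p
    using V.vector_space_axioms g(1) p
    by (intro finite_order_operator.intro complex_operator.intro complex_operator_axioms.intro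
        finite_order_operator_axioms.intro)
  interpret P: finite_order_operator sW \<Phi> p
    using W.vector_space_axioms linear p(1) \<Phi>p
    by (intro finite_order_operator.intro complex_operator.intro complex_operator_axioms.intro
        finite_order_operator_axioms.intro)
  interpret E: irreducible_equivariant_module sV Y vac sW YW g p \<Phi>
    by (intro irreducible_equivariant_module.intro equivariant_module.intro
        equivariant_module_axioms.intro M.full_weak_module_axioms G.finite_order_operator_axioms
        P.finite_order_operator_axioms M.irreducible_full_weak_module_axioms equivariant g(2))
  define Wi where "Wi i = eigenspace sW \<Phi> (\<zeta> ^ i)" for i
  note prim = assms(4)
  note root = primitive_root_power_eq_1[OF prim]
  have "\<zeta> ^ p = 1"
    using prim by (simp add: primitive_root_of_unity_def)
  have nonzero: "Wi i \<noteq> {0}" for i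
    unfolding Wi_def
  proof (rule E.eigenspace_nonzero[OF prim])
    show "\<exists>v n w. YW ((g ^^ k) v) n w \<noteq> YW v n w" if "0 < k" "k < p" for k
      using assms(7) that by (auto simp: twist_def fun_eq_iff)
  qed
  have irreducible: "irreducible_weak_module sV Y vac (fixed_subalgebra g) sW YW (Wi i)" for i
    using nonzero[of i] unfolding Wi_def by (intro E.irreducible_eigenspace root)
  have non_iso: "\<not> isomorphic_weak_modules (fixed_subalgebra g) sW YW (Wi i) sW YW (Wi j)"
    if "i < p" "j < p" "i \<noteq> j" for i j
  proof -
    have "\<zeta> ^ i \<noteq> \<zeta> ^ j"
      using primitive_root_inj[OF prim] that by (auto dest: inj_onD)
    then show ?thesis
      using nonzero[of i] unfolding Wi_def by (intro E.eigenspaces_not_isomorphic[OF B] root)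
  qed
  have direct: "direct_sum_of sW {..<p} Wi UNIV"
    unfolding Wi_def by (rule P.direct_sum_eigenspaces[OF prim])
  \<comment> \<open>Equal members would be isomorphic through the identity, contrary to
    \<open>non_iso\<close>.\<close>
  have "inj_on Wi {..<p}"
  proof (rule inj_onI, rule ccontr)
    fix i j assume *: "i \<in> {..<p}" "j \<in> {..<p}" "Wi i = Wi j" "i \<noteq> j"
    have "isomorphic_weak_modules (fixed_subalgebra g) sW YW (Wi i) sW YW (Wi i)"
      unfolding isomorphic_weak_modules_def by (intro exI[of _ id]) auto
    with * show False
      using non_iso[of i j] by simp
  qed
  then have "direct_sum_of sW (Wi ` {..<p}) (\<lambda>U. U) UNIV"
    using direct by (intro direct_sum_of_image)
  moreover have "weak_module sV Y vac (fixed_subalgebra g) sW YW UNIV"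
    by (intro M.weak_module_restrict E.vertex_subalgebra_fixed) auto
  ultimately have "completely_reducible_weak_module sV Y vac (fixed_subalgebra g) sW YW UNIV"
    unfolding completely_reducible_weak_module_def using irreducible by blast
  moreover have "mode_span sW YW (eigenspace sV g (\<zeta> ^ i)) (Wi j) \<subseteq> Wi ((i + j) mod p)" for i j
  proof -
    have "\<zeta> ^ ((i + j) mod p) * (\<zeta> ^ p) ^ ((i + j) div p) = \<zeta> ^ (i + j)"
      by (simp only: mod_mult_div_eq flip: power_mult power_add)
    then have "\<zeta> ^ ((i + j) mod p) = \<zeta> ^ i * \<zeta> ^ j"
      by (simp add: \<open>\<zeta> ^ p = 1\<close> power_add)
    then show ?thesis
      unfolding Wi_def using E.mode_span_eigenspace by simp
  qed
  moreover have "bij \<Phi>"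
  proof -
    obtain q where q: "p = Suc q"
      using gr0_implies_Suc[OF p(1)] by blast
    show ?thesis
    proof (rule o_bij)
      show "\<Phi> ^^ q \<circ> \<Phi> = id"
        using \<Phi>p unfolding q funpow_Suc_right .
      show "\<Phi> \<circ> \<Phi> ^^ q = id"
        using \<Phi>p unfolding q by simp
    qed
  qed
  ultimately show ?thesis
    using linear equivariant direct irreducible non_iso
    by (intro conjI exI[of _ \<Phi>] exI[of _ Wi] allI impI Wi_def)
qed

end
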